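(* Let $a\in C^3[0,1]$ and $b\in C^2[0,1]$ be real-valued functions, let $(\lambda_n)_{n\in\mathbb{Z}\setminus\{0\}}$ be the eigenvalues of the problem $$u_{xx}-(\lambda^{2}+2\lambda a(x)-b(x))u=0,\quad x\in(0,1),\qquad u(0)=u(1)=0,$$ enumerated as described in the context, and let $c_0,c_1$ be the coefficients in their asymptotics $$\lambda_n=\pi n\,\mathrm{i}+c_0+c_1 n^{-1}+\mathcal{O}(n^{-2}),\qquad n\to\pm\infty .$$ Then the function $a$ is constant if and only if $$c_0^2=2\pi \mathrm{i}\,c_1-\langle b\rangle,$$ in which case $a(x)\equiv -c_0$.
   Context: For a function $f$ on $[0,1]$, $\langle f\rangle:=\int_0^1 f(x)\,dx$. A number $\lambda\in\mathbb{C}$ is an eigenvalue of the problem $u_{xx}-(\lambda^{2}+2\lambda a-b)u=0$ on $(0,1)$, $u(0)=u(1)=0$, if the problem has a nontrivial solution $u$. Equivalently, $\lambda$ is a zero of the entire function $\gamma_0(\lambda):=u(1,\lambda)$, where $u(x,\lambda)$ solves the differential equation with $u(0,\lambda)=0$, $u_x(0,\lambda)=1$. Eigenvalues are repeated according to their multiplicity as zeros of $\gamma_0$. Since $a,b$ are real, $\overline{\lambda}$ is an eigenvalue whenever $\lambda$ is. The eigenvalues are enumerated as $\lambda_n$, $n\in\mathbb{Z}\setminus\{0\}$, with $$\ldots\le \mathrm{Im}\,\lambda_{-2}\le \mathrm{Im}\,\lambda_{-1}\le \mathrm{Im}\,\lambda_1\le \mathrm{Im}\,\lambda_2\le\ldots$$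 and $\lambda_{-n}=\overline{\lambda_n}$ whenever $\lambda_n$ is not real. For $a\in C^3[0,1]$, $b\in C^2[0,1]$ the eigenvalues do admit an asymptotic expansion of the form used in the claim, with $c_0,c_1\in\mathbb{C}$ independent of $n$. *)

theory Defs
  imports "HOL-Complex_Analysis.Complex_Analysis" "HOL-Library.Landau_Symbols"
begin

(* On a closed interval the derivatives at the endpoints are one-sided. *)
primrec Ck_on :: "nat \<Rightarrow> (real \<Rightarrow> real) \<Rightarrow> real set \<Rightarrow> bool" where
  "Ck_on 0 f S \<longleftrightarrow> continuous_on S f"
| "Ck_on (Suc k) f S \<longleftrightarrow>
     (\<exists>f'. (\<forall>x\<in>S. (f has_real_derivative f' x) (at x within S)) \<and> Ck_on k f' S)"

definition mean :: "(real \<Rightarrow> real) \<Rightarrow> real" where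
  "mean f = integral {0..1} f"

(* u solves u_xx - (lam^2 + 2 lam a - b) u = 0 and v = u_x; for continuous a and b
   every solution on the open interval extends to such a pair on the closed one. *)
definition solves_ode ::
  "(real \<Rightarrow> real) \<Rightarrow> (real \<Rightarrow> real) \<Rightarrow> complex \<Rightarrow> (real \<Rightarrow> complex) \<Rightarrow> (real \<Rightarrow> complex) \<Rightarrow> bool" where
  "solves_ode a b lam u v \<longleftrightarrow>
     (\<forall>x\<in>{0..1}.
        (u has_vector_derivative v x) (at x within {0..1}) \<and>
        (v has_vector_derivative
           (lam\<^sup>2 + 2 * lam * complex_of_real (a x) - complex_of_real (b x)) * u x)
          (at x within {0..1}))"

definition is_eigenvalue :: "(real \<Rightarrow> real) \<Rightarrow> (real \<Rightarrow> real) \<Rightarrow> complex \<Rightarrow> bool" where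
  "is_eigenvalue a b lam \<longleftrightarrow>
     (\<exists>u v. solves_ode a b lam u v \<and> u 0 = 0 \<and> u 1 = 0 \<and> (\<exists>x\<in>{0..1}. u x \<noteq> 0))"

(* The initial value problem determines u only on [0,1], so the description ranges over
   the value at 1 and not over the function. *)
definition gamma0 :: "(real \<Rightarrow> real) \<Rightarrow> (real \<Rightarrow> real) \<Rightarrow> complex \<Rightarrow> complex" where
  "gamma0 a b lam = (THE z. \<exists>u v. solves_ode a b lam u v \<and> u 0 = 0 \<and> v 0 = 1 \<and> u 1 = z)"

(* The value lam 0 is irrelevant. The second conjunct says that each eigenvalue is listed
   as often as its multiplicity as a zero of gamma0. *)
definition eigenvalue_enumeration ::
  "(real \<Rightarrow> real) \<Rightarrow> (real \<Rightarrow> real) \<Rightarrow> (int \<Rightarrow> complex) \<Rightarrow> bool" where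
  "eigenvalue_enumeration a b lam \<longleftrightarrow>
     (\<forall>n. n \<noteq> 0 \<longrightarrow> is_eigenvalue a b (lam n)) \<and>
     (\<forall>z. is_eigenvalue a b z \<longrightarrow>
        finite {n. n \<noteq> 0 \<and> lam n = z} \<and>
        int (card {n. n \<noteq> 0 \<and> lam n = z}) = zorder (gamma0 a b) z) \<and>
     (\<forall>m n. m \<noteq> 0 \<and> n \<noteq> 0 \<and> m \<le> n \<longrightarrow> Im (lam m) \<le> Im (lam n)) \<and>
     (\<forall>n. n \<noteq> 0 \<and> lam n \<notin> \<real> \<longrightarrow> lam (- n) = cnj (lam n))"

definition eigenvalue_asymptotics :: "(int \<Rightarrow> complex) \<Rightarrow> complex \<Rightarrow> complex \<Rightarrow> bool" where
  "eigenvalue_asymptotics lam c0 c1 \<longleftrightarrow>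
     (\<forall>F\<in>{at_top, at_bot}.
        (\<lambda>n. lam n - (complex_of_real pi * of_int n * \<i> + c0 + c1 / of_int n))
          \<in> O[F](\<lambda>n. 1 / (of_int n)\<^sup>2))"

end

theory Submission
  imports Defs
begin

text \<open>
  Put \<open>\<sigma> = \<lambda> + a - (a\<^sup>2 + b + a') / (2\<lambda>)\<close> and let \<open>P\<close> be its antiderivative vanishing at 0.
  Then \<open>exp P\<close> solves the differential equation with residual \<open>O(1/\<lambda>) exp P\<close>, and so does the
  function \<open>exp Q\<close> obtained from \<open>(-\<lambda>, -a)\<close>. For an eigenfunction \<open>u\<close> with \<open>u'(0) = 1\<close> and bounded \<open>Re \<lambda>\<close>, the
  Wronskians of \<open>u\<close> with \<open>exp P\<close> and \<open>exp Q\<close> are constant up to \<open>O(\<lambda>\<^sup>-\<^sup>2)\<close>. At 0 they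
  coincide, and at 1, where \<open>u\<close> vanishes, their ratio is \<open>exp (P - Q)\<close>. Thus
  \<open>exp (2\<lambda> + 2\<langle>a\<rangle> - \<langle>a\<^sup>2 + b\<rangle>/\<lambda>) = 1 + O(\<lambda>\<^sup>-\<^sup>2)\<close>. Inserting the asymptotics of \<open>\<lambda>\<^sub>n\<close> gives
  \<open>c0 = -\<langle>a\<rangle>\<close> modulo \<open>\<pi>i\<close> and \<open>2\<pi>i c1 = \<langle>a\<^sup>2 + b\<rangle>\<close>; the first ambiguity disappears because the
  conjugation symmetry forces \<open>c0\<close> to be real. The identity for \<open>c0\<close> and \<open>c1\<close> then says
  \<open>\<langle>a\<rangle>\<^sup>2 = \<langle>a\<^sup>2\<rangle>\<close>, that is, \<open>a\<close> has variance zero.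
\<close>

section \<open>Almost constant Wronskians\<close>

lemma vector_derivative_increment_le:
  fixes f :: "real \<Rightarrow> 'a::real_normed_vector"
  assumes f: "\<And>x. x \<in> {0..1} \<Longrightarrow> (f has_vector_derivative f' x) (at x within {0..1})"
    and B: "\<And>x. x \<in> {0..1} \<Longrightarrow> norm (f' x) \<le> B"
    and x: "x \<in> {0..1}"
  shows "norm (f x - f 0) \<le> B"
proof -
  have "norm (f x - f 0) \<le> B * norm (x - 0)"
  proof (rule differentiable_bound[of "{0..1}" f "\<lambda>x h. h *\<^sub>R f' x"])
    show "onorm (\<lambda>h. h *\<^sub>R f' t) \<le> B" if "t \<in> {0..1}" for t
      by (rule onorm_le) (use mult_right_mono[OF B[OF that] abs_ge_zero] in \<open>simp add: mult.commute\<close>)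
  qed (use f x in \<open>auto simp: has_vector_derivative_def\<close>)
  also have "\<dots> \<le> B * 1"
    using x order_trans[OF norm_ge_zero B[of 0]] by (intro mult_left_mono) auto
  finally show ?thesis by simp
qed

text \<open>\<open>(v - \<sigma> u) exp P\<close> is the Wronskian of \<open>u\<close> and \<open>exp P\<close>.\<close>
lemma wronskian_increment_le:
  fixes u v \<sigma> \<sigma>' P :: "real \<Rightarrow> complex"
  assumes sol: "solves_ode a b lam u v"
    and \<sigma>: "\<And>x. x \<in> {0..1} \<Longrightarrow> (\<sigma> has_vector_derivative \<sigma>' x) (at x within {0..1})"
    and P: "\<And>x. x \<in> {0..1} \<Longrightarrow> (P has_vector_derivative \<sigma> x) (at x within {0..1})"
    and res: "\<And>x. x \<in> {0..1} \<Longrightarrow>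
      norm (lam\<^sup>2 + 2 * lam * complex_of_real (a x) - complex_of_real (b x) - \<sigma>' x - (\<sigma> x)\<^sup>2) \<le> \<epsilon>"
    and M: "\<And>x. x \<in> {0..1} \<Longrightarrow> norm (u x) \<le> M"
    and R: "\<And>x. x \<in> {0..1} \<Longrightarrow> \<bar>Re (P x)\<bar> \<le> R"
    and x: "x \<in> {0..1}"
  shows "norm ((v x - \<sigma> x * u x) * exp (P x) - (v 0 - \<sigma> 0 * u 0) * exp (P 0)) \<le> \<epsilon> * M * exp R"
proof (rule vector_derivative_increment_le[where f = "\<lambda>x. (v x - \<sigma> x * u x) * exp (P x)", OF _ _ x])
  let ?r = "\<lambda>x. lam\<^sup>2 + 2 * lam * complex_of_real (a x) - complex_of_real (b x) - \<sigma>' x - (\<sigma> x)\<^sup>2"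
  fix t :: real assume t: "t \<in> {0..1}"
  have u: "(u has_vector_derivative v t) (at t within {0..1})"
    and v: "(v has_vector_derivative
       (lam\<^sup>2 + 2 * lam * complex_of_real (a t) - complex_of_real (b t)) * u t) (at t within {0..1})"
    using sol t by (auto simp: solves_ode_def)
  have "((exp \<circ> P) has_vector_derivative (\<sigma> t * exp (P t))) (at t within {0..1})"
    by (rule field_vector_diff_chain_within[OF P[OF t]])
      (auto intro: DERIV_exp has_field_derivative_at_within)
  then have "((\<lambda>x. exp (P x)) has_vector_derivative (\<sigma> t * exp (P t))) (at t within {0..1})"
    by (simp add: o_def)
  \<comment> \<open>The terms in \<open>v t\<close> cancel in the product rule, which leaves the
    Riccati residual times \<open>u t * exp (P t)\<close>.\<close>
  from has_vector_derivative_mult[OF has_vector_derivative_diff[OF v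
      has_vector_derivative_mult[OF \<sigma>[OF t] u]] this]
  show "((\<lambda>x. (v x - \<sigma> x * u x) * exp (P x)) has_vector_derivative ?r t * u t * exp (P t))
      (at t within {0..1})"
    by (rule has_vector_derivative_eq_rhs) (simp add: algebra_simps power2_eq_square)
  have "norm (exp (P t)) \<le> exp R"
    using R[OF t] by (simp add: norm_exp_eq_Re)
  then show "norm (?r t * u t * exp (P t)) \<le> \<epsilon> * M * exp R"
    unfolding norm_mult using res[OF t] M[OF t]
    by (intro mult_mono)
      (auto intro!: mult_nonneg_nonneg intro: order_trans[OF norm_ge_zero])
qed

section \<open>Quantization from two approximate solutions\<close>

text \<open>The Wronskian errors are proportional to the size of \<open>u\<close>, whereas the
  conclusion needs them relative to the initial slope \<open>v 0\<close>. The gap closes this loop: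
  without their exponential weights the two Wronskians differ by
  \<open>(\<sigma> x - \<tau> x) * u x\<close>, so the slope controls \<open>u\<close>.\<close>

lemma approximate_quantization:
  fixes \<sigma> \<sigma>' P \<tau> \<tau>' Q :: "real \<Rightarrow> complex"
  assumes ev: "is_eigenvalue a b lam"
    and \<sigma>: "\<And>x. x \<in> {0..1} \<Longrightarrow> (\<sigma> has_vector_derivative \<sigma>' x) (at x within {0..1})"
    and P: "\<And>x. x \<in> {0..1} \<Longrightarrow> (P has_vector_derivative \<sigma> x) (at x within {0..1})"
    and res\<sigma>: "\<And>x. x \<in> {0..1} \<Longrightarrow>
      norm (lam\<^sup>2 + 2 * lam * complex_of_real (a x) - complex_of_real (b x) - \<sigma>' x - (\<sigma> x)\<^sup>2) \<le> \<epsilon>"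
    and RP: "\<And>x. x \<in> {0..1} \<Longrightarrow> \<bar>Re (P x)\<bar> \<le> R"
    and \<tau>: "\<And>x. x \<in> {0..1} \<Longrightarrow> (\<tau> has_vector_derivative \<tau>' x) (at x within {0..1})"
    and Q: "\<And>x. x \<in> {0..1} \<Longrightarrow> (Q has_vector_derivative \<tau> x) (at x within {0..1})"
    and res\<tau>: "\<And>x. x \<in> {0..1} \<Longrightarrow>
      norm (lam\<^sup>2 + 2 * lam * complex_of_real (a x) - complex_of_real (b x) - \<tau>' x - (\<tau> x)\<^sup>2) \<le> \<epsilon>"
    and RQ: "\<And>x. x \<in> {0..1} \<Longrightarrow> \<bar>Re (Q x)\<bar> \<le> R"
    and init: "P 0 = 0" "Q 0 = 0"
    and gap: "\<And>x. x \<in> {0..1} \<Longrightarrow> \<delta> \<le> norm (\<sigma> x - \<tau> x)" "0 < \<delta>"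
    and small: "8 * \<epsilon> * (exp R)\<^sup>2 \<le> \<delta>"
  shows "norm (exp (P 1 - Q 1) - 1) \<le> 16 * \<epsilon> * (exp R)\<^sup>2 / \<delta>"
proof -
  define K where "K = exp R"
  have K: "K > 0" by (simp add: K_def)
  have \<epsilon>: "\<epsilon> \<ge> 0" using order_trans[OF norm_ge_zero res\<sigma>[of 0]] by simp
  obtain u v where sol: "solves_ode a b lam u v" and u0: "u 0 = 0" and u1: "u 1 = 0"
    and nz: "\<exists>x\<in>{0..1}. u x \<noteq> 0"
    using ev unfolding is_eigenvalue_def by blast
  have "continuous_on {0..1} u"
    using sol unfolding solves_ode_def continuous_on_eq_continuous_within
    by (blast intro: has_vector_derivative_continuous)
  then have "continuous_on {0..1} (\<lambda>x. norm (u x))" by (intro continuous_intros)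
  then obtain x0 where x0: "x0 \<in> {0..1}" and max: "\<And>x. x \<in> {0..1} \<Longrightarrow> norm (u x) \<le> norm (u x0)"
    using continuous_attains_sup[of "{0..1::real}" "\<lambda>x. norm (u x)"] by auto
  define M where "M = norm (u x0)"
  have Mpos: "M > 0"
  proof -
    obtain x where "x \<in> {0..1}" "u x \<noteq> 0" using nz by blast
    then show ?thesis using max[of x] by (auto simp: M_def simp del: atLeastAtMost_iff)
  qed
  \<comment> \<open>The common initial value of both Wronskians, as \<open>u\<close>,
    \<open>P\<close> and \<open>Q\<close> vanish at 0. It is not normalised to 1; that it is nonzero
    will follow from the estimate of \<open>M\<close>.\<close>
  define d where "d = v 0"
  have WP: "norm ((v x - \<sigma> x * u x) * exp (P x) - d) \<le> \<epsilon> * M * K" if "x \<in> {0..1}" for x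
    using wronskian_increment_le[OF sol \<sigma> P res\<sigma> _ RP that, of M] max u0 init
    by (simp add: K_def M_def d_def)
  have WQ: "norm ((v x - \<tau> x * u x) * exp (Q x) - d) \<le> \<epsilon> * M * K" if "x \<in> {0..1}" for x
    using wronskian_increment_le[OF sol \<tau> Q res\<tau> _ RQ that, of M] max u0 init
    by (simp add: K_def M_def d_def)
  \<comment> \<open>Since the real part is bounded on both sides, \<open>K\<close> also bounds
    \<open>exp (- z)\<close>, so the exponential weight can be removed.\<close>
  have undo: "norm w \<le> K * (norm d + \<epsilon> * M * K)"
    if "norm (w * exp z - d) \<le> \<epsilon> * M * K" "\<bar>Re z\<bar> \<le> R" for w z
  proof -
    have "norm (w * exp z) \<le> norm d + \<epsilon> * M * K"
      using that(1) norm_triangle_sub[of "w * exp z" d] by linarith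
    moreover have "norm (exp (- z)) \<le> K"
      using that(2) by (simp add: norm_exp_eq_Re K_def)
    ultimately have "norm (exp (- z)) * norm (w * exp z) \<le> K * (norm d + \<epsilon> * M * K)"
      using K by (intro mult_mono) auto
    moreover have "exp (- z) * (w * exp z) = w"
      by (simp add: exp_minus)
    ultimately show ?thesis by (metis norm_mult)
  qed
  \<comment> \<open>Two Wronskians recover \<open>u\<close> from \<open>d\<close> up to a small multiple of \<open>M\<close>, which is absorbed.\<close>
  have "M * \<delta> \<le> norm (u x0) * norm (\<sigma> x0 - \<tau> x0)"
    unfolding M_def by (intro mult_left_mono gap x0) simp
  also have "\<dots> = norm ((v x0 - \<tau> x0 * u x0) - (v x0 - \<sigma> x0 * u x0))"
    by (simp add: norm_mult[symmetric] algebra_simps)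
  also have "\<dots> \<le> 2 * (K * (norm d + \<epsilon> * M * K))"
    using norm_triangle_ineq4[of "v x0 - \<tau> x0 * u x0" "v x0 - \<sigma> x0 * u x0"]
      undo[OF WP[OF x0] RP[OF x0]] undo[OF WQ[OF x0] RQ[OF x0]] by linarith
  also have "\<dots> = 2 * K * norm d + 2 * (\<epsilon> * K\<^sup>2) * M"
    by (simp add: algebra_simps power2_eq_square)
  finally have 1: "M * \<delta> \<le> 2 * K * norm d + 2 * (\<epsilon> * K\<^sup>2) * M" .
  \<comment> \<open>By \<open>small\<close> the term with \<open>M\<close> on the right is at most a
    quarter of \<open>M * \<delta>\<close>; the constant 4 below then holds with room to
    spare.\<close>
  have "M * (8 * (\<epsilon> * K\<^sup>2)) \<le> M * \<delta>"
    using small Mpos by (intro mult_left_mono) (simp_all add: K_def mult.assoc)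
  moreover have "M * (8 * (\<epsilon> * K\<^sup>2)) = 4 * (2 * (\<epsilon> * K\<^sup>2) * M)" by simp
  ultimately have MD: "M * \<delta> \<le> 4 * K * norm d"
    using 1 mult_nonneg_nonneg[OF less_imp_le[OF K] norm_ge_zero[of d]] by linarith
  have "M * \<delta> > 0" using Mpos gap(2) by simp
  with MD have "4 * K * norm d > 0" by linarith
  then have d: "norm d > 0" using K by (simp add: zero_less_mult_iff)
  define \<eta> where "\<eta> = \<epsilon> * M * K"
  have \<eta>: "\<eta> \<le> 4 * \<epsilon> * K\<^sup>2 / \<delta> * norm d"
  proof -
    have "M \<le> 4 * K * norm d / \<delta>" using MD gap(2) by (simp add: field_simps)
    then have "\<epsilon> * K * M \<le> \<epsilon> * K * (4 * K * norm d / \<delta>)"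
      using \<epsilon> K by (intro mult_left_mono) auto
    then show ?thesis by (simp add: \<eta>_def power2_eq_square mult_ac)
  qed
  \<comment> \<open>This is exactly what the 8 in \<open>small\<close> provides: the error at 1 is
    at most half of \<open>norm d\<close>, so \<open>v 1 * exp (Q 1)\<close> stays away from 0 and
    can serve as denominator.\<close>
  also have "\<dots> \<le> 1/2 * norm d"
    using small gap(2) by (intro mult_right_mono) (auto simp: field_simps K_def)
  finally have \<eta>2: "\<eta> \<le> norm d / 2" by simp
  have e1: "norm (v 1 * exp (P 1) - d) \<le> \<eta>" and e2: "norm (v 1 * exp (Q 1) - d) \<le> \<eta>"
    using WP[of 1] WQ[of 1] u1 by (simp_all add: \<eta>_def)
  have low: "norm d / 2 \<le> norm (v 1 * exp (Q 1))"
    using e2 \<eta>2 norm_triangle_sub[of d "v 1 * exp (Q 1)"] by (simp add: norm_minus_commute)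
  have v1: "v 1 \<noteq> 0" using low d by auto
  have "exp (P 1 - Q 1) - 1 = (v 1 * exp (P 1) - v 1 * exp (Q 1)) / (v 1 * exp (Q 1))"
    using v1 by (simp add: exp_diff field_simps)
  also have "norm \<dots> \<le> (2 * \<eta>) / (norm d / 2)"
    unfolding norm_divide
  proof (rule frac_le)
    show "norm (v 1 * exp (P 1) - v 1 * exp (Q 1)) \<le> 2 * \<eta>"
      using norm_triangle_ineq4[of "v 1 * exp (P 1) - d" "v 1 * exp (Q 1) - d"] e1 e2 by simp
    show "0 \<le> 2 * \<eta>" using order_trans[OF norm_ge_zero e1] by simp
  qed (use low d in auto)
  also have "\<dots> \<le> 16 * \<epsilon> * K\<^sup>2 / \<delta>"
  proof -
    have "\<eta> / norm d \<le> 4 * \<epsilon> * K\<^sup>2 / \<delta>"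
      using \<eta> d by (simp only: pos_divide_le_eq)
    then show ?thesis by simp
  qed
  finally show ?thesis by (simp add: K_def)
qed

section \<open>WKB exponents\<close>

lemma bounded_on_unit_interval:
  fixes f :: "real \<Rightarrow> real"
  assumes "continuous_on {0..1} f"
  obtains B where "0 \<le> B" "\<And>x. x \<in> {0..1} \<Longrightarrow> \<bar>f x\<bar> \<le> B"
proof -
  have "bounded (f ` {0..1})"
    by (intro compact_imp_bounded compact_continuous_image assms compact_Icc)
  then obtain B where B: "\<forall>x\<in>{0..1}. \<bar>f x\<bar> \<le> B" by (auto simp: bounded_iff)
  moreover have "0 \<le> B" using B using order_trans[OF abs_ge_zero, of "f 0" B] by auto
  ultimately show ?thesis using that by blast
qed

text \<open>The residual is that of the Riccati equation \<open>\<sigma>' + \<sigma>\<^sup>2 = \<lambda>\<^sup>2 + 2\<lambda>a - b\<close>, whose solutions are the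
  logarithmic derivatives of solutions of the linear equation.\<close>
definition wkb_exponent ::
  "(real \<Rightarrow> real) \<Rightarrow> (real \<Rightarrow> real) \<Rightarrow> complex \<Rightarrow> real \<Rightarrow>
    (real \<Rightarrow> complex) \<Rightarrow> (real \<Rightarrow> complex) \<Rightarrow> (real \<Rightarrow> complex) \<Rightarrow> bool" where
  "wkb_exponent a b lam C \<sigma> \<sigma>' P \<longleftrightarrow>
     (\<forall>x\<in>{0..1}.
        (\<sigma> has_vector_derivative \<sigma>' x) (at x within {0..1}) \<and>
        (P has_vector_derivative \<sigma> x) (at x within {0..1}) \<and>
        norm (lam\<^sup>2 + 2 * lam * complex_of_real (a x) - complex_of_real (b x) - \<sigma>' x - (\<sigma> x)\<^sup>2)
          \<le> C / norm lam \<and>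
        \<bar>Re (P x)\<bar> \<le> \<bar>Re lam\<bar> + C \<and>
        norm (\<sigma> x - lam) \<le> C) \<and>
     P 0 = 0 \<and>
     P 1 = lam + complex_of_real (mean a)
       - complex_of_real (mean (\<lambda>x. (a x)\<^sup>2 + b x) + (a 1 - a 0)) / (2 * lam)"

text \<open>Truncated WKB ansatz \<open>lam + a + s / lam\<close>: in the Riccati equation the
  orders 2 and 1 in \<open>lam\<close> match by themselves, \<open>s\<close> is chosen to match
  order 0, and a residual of order -1 remains. Its coefficients are continuous on a compact
  interval, so \<open>C\<close> does not depend on \<open>lam\<close>.\<close>

lemma wkb_exponent_exists:
  fixes a a' a'' b b' :: "real \<Rightarrow> real"
  assumes a: "\<And>x. x \<in> {0..1} \<Longrightarrow> (a has_real_derivative a' x) (at x within {0..1})"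
    and a': "\<And>x. x \<in> {0..1} \<Longrightarrow> (a' has_real_derivative a'' x) (at x within {0..1})"
    and a'': "continuous_on {0..1} a''"
    and b: "\<And>x. x \<in> {0..1} \<Longrightarrow> (b has_real_derivative b' x) (at x within {0..1})"
    and b': "continuous_on {0..1} b'"
  shows "\<exists>C\<ge>0. \<forall>lam. 1 \<le> norm lam \<longrightarrow> (\<exists>\<sigma> \<sigma>' P. wkb_exponent a b lam C \<sigma> \<sigma>' P)"
proof -
  have ca: "continuous_on {0..1} a" and ca': "continuous_on {0..1} a'" and cb: "continuous_on {0..1} b"
    using a a' b unfolding continuous_on_eq_continuous_within
    by (blast intro: DERIV_continuous)+
  \<comment> \<open>The coefficient of \<open>1/\<lambda>\<close> that cancels the terms of order 0 in the Riccati equation.\<close>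
  define s where "s x = - ((a x)\<^sup>2 + b x + a' x) / 2" for x
  define s' where "s' x = - (2 * a x * a' x + b' x + a'' x) / 2" for x
  define A where "A x = integral {0..x} a" for x
  \<comment> \<open>An antiderivative of \<open>s\<close> with the integral of \<open>a'\<close>
    already evaluated; this is where the boundary term \<open>a 1 - a 0\<close> comes from.\<close>
  define G where "G x = - (integral {0..x} (\<lambda>x. (a x)\<^sup>2 + b x) + (a x - a 0)) / 2" for x
  have s: "(s has_real_derivative s' x) (at x within {0..1})" if "x \<in> {0..1}" for x
    unfolding s_def s'_def using a a' b that
    by (auto intro!: derivative_eq_intros)
  have A: "(A has_real_derivative a x) (at x within {0..1})" if "x \<in> {0..1}" for x
    unfolding A_def using integral_has_real_derivative[OF ca that] .
  have G: "(G has_real_derivative s x) (at x within {0..1})" if x: "x \<in> {0..1}" for x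
  proof -
    have "continuous_on {0..1} (\<lambda>x. (a x)\<^sup>2 + b x)" by (intro continuous_intros ca cb)
    from integral_has_real_derivative[OF this x] a[OF x] show ?thesis
      unfolding G_def s_def by (auto intro!: derivative_eq_intros)
  qed
  have cs: "continuous_on {0..1} s" and cs': "continuous_on {0..1} s'"
    unfolding s_def s'_def by (intro continuous_intros ca ca' cb b' a''; simp)+
  have cA: "continuous_on {0..1} A" and cG: "continuous_on {0..1} G"
    using A G unfolding continuous_on_eq_continuous_within by (blast intro: DERIV_continuous)+
  obtain Ba where Ba: "0 \<le> Ba" "\<And>x. x \<in> {0..1} \<Longrightarrow> \<bar>a x\<bar> \<le> Ba" using bounded_on_unit_interval[OF ca] by metis
  obtain Bs where Bs: "0 \<le> Bs" "\<And>x. x \<in> {0..1} \<Longrightarrow> \<bar>s x\<bar> \<le> Bs" using bounded_on_unit_interval[OF cs] by metis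
  obtain BA where BA: "0 \<le> BA" "\<And>x. x \<in> {0..1} \<Longrightarrow> \<bar>A x\<bar> \<le> BA" using bounded_on_unit_interval[OF cA] by metis
  obtain BG where BG: "0 \<le> BG" "\<And>x. x \<in> {0..1} \<Longrightarrow> \<bar>G x\<bar> \<le> BG" using bounded_on_unit_interval[OF cG] by metis
  have "continuous_on {0..1} (\<lambda>x. 2 * a x * s x + s' x)" by (intro continuous_intros ca cs cs')
  then obtain Br where Br: "0 \<le> Br" "\<And>x. x \<in> {0..1} \<Longrightarrow> \<bar>2 * a x * s x + s' x\<bar> \<le> Br"
    using bounded_on_unit_interval by (metis (lifting))
  \<comment> \<open>The three groups bound the residual, the real part of the exponent and the
    distance of \<open>\<sigma>\<close> from \<open>lam\<close>.\<close>
  define C where "C = (Br + Bs\<^sup>2) + (BA + BG) + (Ba + Bs)"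
  show ?thesis
  proof (intro exI[of _ C] conjI allI impI)
    show "0 \<le> C" using Ba Bs BA BG Br by (simp add: C_def)
    fix lam :: complex assume lam: "1 \<le> norm lam"
    then have lam0: "lam \<noteq> 0" by auto
    have quot: "norm (z / lam) \<le> norm z" for z
      using lam lam0 by (simp add: norm_divide divide_le_eq mult_le_cancel_left1)
    define \<sigma> where "\<sigma> x = lam + complex_of_real (a x) + complex_of_real (s x) / lam" for x
    define \<sigma>' where "\<sigma>' x = complex_of_real (a' x) + complex_of_real (s' x) / lam" for x
    define P where "P x = lam * complex_of_real x + complex_of_real (A x) + complex_of_real (G x) / lam" for x
    have 1: "(\<sigma> has_vector_derivative \<sigma>' x) (at x within {0..1})" if x: "x \<in> {0..1}" for x
      unfolding \<sigma>_def \<sigma>'_def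
      by (rule has_vector_derivative_eq_rhs, (rule has_vector_derivative_add has_vector_derivative_const
          has_vector_derivative_divide has_vector_derivative_of_real a s x)+) simp
    have 2: "(P has_vector_derivative \<sigma> x) (at x within {0..1})" if x: "x \<in> {0..1}" for x
      unfolding \<sigma>_def P_def
      by (rule has_vector_derivative_eq_rhs, (rule has_vector_derivative_add has_vector_derivative_mult_right
          has_vector_derivative_divide has_vector_derivative_of_real A G x DERIV_ident)+) simp
    have 3: "norm (lam\<^sup>2 + 2 * lam * complex_of_real (a x) - complex_of_real (b x) - \<sigma>' x - (\<sigma> x)\<^sup>2)
          \<le> C / norm lam" if x: "x \<in> {0..1}" for x
    proof -
      \<comment> \<open>Eliminating \<open>b\<close> in favour of \<open>s\<close> turns the
        cancellation of order 0 into a polynomial identity.\<close>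
      have "complex_of_real (b x) + complex_of_real (a' x) + complex_of_real (a x) ^ 2
          = - 2 * complex_of_real (s x)"
        unfolding of_real_add[symmetric] of_real_power[symmetric] of_real_mult[symmetric]
        by (simp add: s_def)
      then have b: "complex_of_real (b x) = - 2 * complex_of_real (s x)
          - complex_of_real (a' x) - complex_of_real (a x) ^ 2" by (simp add: algebra_simps)
      have "lam\<^sup>2 + 2 * lam * complex_of_real (a x) - complex_of_real (b x) - \<sigma>' x - (\<sigma> x)\<^sup>2
          = - (complex_of_real (2 * a x * s x + s' x) + complex_of_real ((s x)\<^sup>2) / lam) / lam"
        unfolding b \<sigma>_def \<sigma>'_def using lam0 by (simp add: field_simps power2_eq_square)
      also have "norm \<dots> \<le> (Br + Bs\<^sup>2) / norm lam"
      proof -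
        have "norm (complex_of_real (2 * a x * s x + s' x) + complex_of_real ((s x)\<^sup>2) / lam) \<le> Br + Bs\<^sup>2"
        proof (rule norm_triangle_le[OF add_mono])
          show "norm (complex_of_real (2 * a x * s x + s' x)) \<le> Br"
            unfolding norm_of_real using Br(2)[OF x] .
          have "norm (complex_of_real ((s x)\<^sup>2)) \<le> Bs\<^sup>2"
            using power_mono[OF Bs(2)[OF x], of 2] by (simp add: norm_power)
          then show "norm (complex_of_real ((s x)\<^sup>2) / lam) \<le> Bs\<^sup>2"
            by (rule order_trans[OF quot])
        qed
        then show ?thesis
          unfolding norm_divide norm_minus_cancel by (rule divide_right_mono) simp
      qed
      also have "\<dots> \<le> C / norm lam"
        using Ba Bs BA BG Br by (intro divide_right_mono) (auto simp: C_def)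
      finally show ?thesis .
    qed
    have 4: "\<bar>Re (P x)\<bar> \<le> \<bar>Re lam\<bar> + C" if x: "x \<in> {0..1}" for x
    proof -
      have "\<bar>Re (complex_of_real (G x) / lam)\<bar> \<le> BG"
        using BG(2)[OF x] by (intro order_trans[OF abs_Re_le_cmod] order_trans[OF quot]) simp
      moreover have "\<bar>Re (lam * complex_of_real x)\<bar> \<le> \<bar>Re lam\<bar>"
        using x by (simp add: abs_mult mult_left_le)
      moreover have "Re (P x) = Re (lam * complex_of_real x) + A x + Re (complex_of_real (G x) / lam)"
        by (simp add: P_def)
      moreover have "BA + BG \<le> C" using Ba Bs BA BG Br by (simp add: C_def)
      ultimately show ?thesis using BA(2)[OF x] by linarith
    qed
    have 5: "norm (\<sigma> x - lam) \<le> C" if x: "x \<in> {0..1}" for x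
    proof -
      have "norm (\<sigma> x - lam) = norm (complex_of_real (a x) + complex_of_real (s x) / lam)"
        by (simp add: \<sigma>_def)
      also have "\<dots> \<le> Ba + Bs"
        using Ba(2)[OF x] Bs(2)[OF x]
        by (intro norm_triangle_le add_mono order_trans[OF quot]) auto
      finally show ?thesis
        using BA(1) BG(1) Br(1) zero_le_power2[of Bs] unfolding C_def by linarith
    qed
    have 6: "P 0 = 0" by (simp add: P_def A_def G_def)
    have 7: "P 1 = lam + complex_of_real (mean a)
        - complex_of_real (mean (\<lambda>x. (a x)\<^sup>2 + b x) + (a 1 - a 0)) / (2 * lam)"
      using lam0 by (simp add: P_def A_def G_def mean_def field_simps)
    from 1 2 3 4 5 6 7 show "\<exists>\<sigma> \<sigma>' P. wkb_exponent a b lam C \<sigma> \<sigma>' P"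
      unfolding wkb_exponent_def by blast
  qed
qed

section \<open>The quantization condition for eigenvalues\<close>

text \<open>The equation is invariant under changing the signs of both \<open>lam\<close> and
  \<open>a\<close>, so the WKB exponents of the two parameter pairs belong to the same equation. A
  residual of order -1 divided by a gap of order 1 gives the error of order -2; the bound on
  \<open>Re lam\<close> keeps the exponentials bounded.\<close>

lemma eigenvalue_quantization:
  fixes a a' a'' b b' :: "real \<Rightarrow> real" and R :: real
  assumes a: "\<And>x. x \<in> {0..1} \<Longrightarrow> (a has_real_derivative a' x) (at x within {0..1})"
    and a': "\<And>x. x \<in> {0..1} \<Longrightarrow> (a' has_real_derivative a'' x) (at x within {0..1})"
    and a'': "continuous_on {0..1} a''"
    and b: "\<And>x. x \<in> {0..1} \<Longrightarrow> (b has_real_derivative b' x) (at x within {0..1})"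
    and b': "continuous_on {0..1} b'"
  obtains C where
    "\<And>lam. \<lbrakk>is_eigenvalue a b lam; \<bar>Re lam\<bar> \<le> R; C \<le> norm lam\<rbrakk> \<Longrightarrow>
      norm (exp (2 * lam + 2 * complex_of_real (mean a)
        - complex_of_real (mean (\<lambda>x. (a x)\<^sup>2 + b x)) / lam) - 1) \<le> C / (norm lam)\<^sup>2"
proof -
  obtain C1 where C1: "0 \<le> C1"
    and w1: "\<And>lam. 1 \<le> norm lam \<Longrightarrow> \<exists>\<sigma> \<sigma>' P. wkb_exponent a b lam C1 \<sigma> \<sigma>' P"
    using wkb_exponent_exists[OF assms] by blast
  have "\<exists>C\<ge>0. \<forall>lam. 1 \<le> norm lam \<longrightarrow> (\<exists>\<sigma> \<sigma>' P. wkb_exponent (\<lambda>x. - a x) b lam C \<sigma> \<sigma>' P)"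
    by (rule wkb_exponent_exists[of _ "\<lambda>x. - a' x" "\<lambda>x. - a'' x" b b'])
      (use assms in \<open>auto intro!: DERIV_minus continuous_on_minus\<close>)
  then obtain C2 where
    w2: "\<And>lam. 1 \<le> norm lam \<Longrightarrow> \<exists>\<sigma> \<sigma>' P. wkb_exponent (\<lambda>x. - a x) b lam C2 \<sigma> \<sigma>' P"
    by blast
  define D where "D = max C1 C2"
  have D: "0 \<le> D" "C1 \<le> D" "C2 \<le> D" using C1 by (auto simp: D_def)
  define K where "K = exp (R + D)"
  \<comment> \<open>The summand 1 admits the WKB exponents, \<open>2 * D\<close> secures the gap,
    and the last summand covers both the smallness condition and the final constant.\<close>
  define C where "C = 1 + 2 * D + 16 * D * K\<^sup>2"
  show ?thesis
  proof (rule that[of C])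
    fix lam assume ev: "is_eigenvalue a b lam" and R: "\<bar>Re lam\<bar> \<le> R" and large: "C \<le> norm lam"
    have lam: "1 \<le> norm lam" "2 * D \<le> norm lam" "8 * D * K\<^sup>2 \<le> norm lam"
    proof -
      have "0 \<le> D * K\<^sup>2" using D by simp
      then show "1 \<le> norm lam" "2 * D \<le> norm lam" "8 * D * K\<^sup>2 \<le> norm lam"
        using large D unfolding C_def by linarith+
    qed
    then have lam0: "lam \<noteq> 0" by auto
    obtain \<sigma> \<sigma>' P where \<sigma>: "wkb_exponent a b lam C1 \<sigma> \<sigma>' P"
      using w1[OF lam(1)] by blast
    obtain \<tau> \<tau>' Q where \<tau>: "wkb_exponent (\<lambda>x. - a x) b (- lam) C2 \<tau> \<tau>' Q"
      using w2[of "- lam"] lam(1) by auto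
    have P: "P 0 = 0" "P 1 = lam + complex_of_real (mean a)
        - complex_of_real (mean (\<lambda>x. (a x)\<^sup>2 + b x) + (a 1 - a 0)) / (2 * lam)"
      using \<sigma> by (simp_all add: wkb_exponent_def)
    have Q: "Q 0 = 0" "Q 1 = - lam - complex_of_real (mean a)
        + complex_of_real (mean (\<lambda>x. (a x)\<^sup>2 + b x) - (a 1 - a 0)) / (2 * lam)"
      using \<tau> by (simp_all add: wkb_exponent_def mean_def)
    have bounds: "C1 / norm lam \<le> D / norm lam" "C2 / norm lam \<le> D / norm lam"
      "\<bar>Re lam\<bar> + C1 \<le> R + D" "\<bar>Re lam\<bar> + C2 \<le> R + D"
      using D R by (auto intro: divide_right_mono)
    have "norm (exp (P 1 - Q 1) - 1) \<le> 16 * (D / norm lam) * (exp (R + D))\<^sup>2 / norm lam"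
    proof (rule approximate_quantization[OF ev, of \<sigma> \<sigma>' P "D / norm lam" "R + D" \<tau> \<tau>' Q])
      fix x :: real assume x: "x \<in> {0..1}"
      have "norm (\<sigma> x - lam) \<le> C1" "norm (\<tau> x - - lam) \<le> C2"
        using \<sigma> \<tau> x unfolding wkb_exponent_def by blast+
      then have "norm (\<sigma> x - lam) \<le> D" "norm (\<tau> x + lam) \<le> D" using D by simp_all
      \<comment> \<open>The difference of the logarithmic derivatives is \<open>2 * lam\<close> up
        to an error \<open>2 * D\<close>, which is at most \<open>norm lam\<close>.\<close>
      moreover have "2 * norm lam = norm ((\<sigma> x - \<tau> x) - ((\<sigma> x - lam) - (\<tau> x + lam)))"
        by (simp add: norm_mult[symmetric])
      moreover have "\<dots> \<le> norm (\<sigma> x - \<tau> x) + (norm (\<sigma> x - lam) + norm (\<tau> x + lam))"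
        by (meson norm_triangle_ineq4 order_trans add_left_mono)
      ultimately show "norm lam \<le> norm (\<sigma> x - \<tau> x)" using lam by linarith
    next
      have "8 * D * K\<^sup>2 \<le> norm lam * norm lam"
        using lam mult_mono[of 1 "norm lam" "norm lam" "norm lam"] by simp
      then show "8 * (D / norm lam) * (exp (R + D))\<^sup>2 \<le> norm lam"
        using lam0 by (simp add: field_simps K_def)
    next
      fix x :: real assume x: "x \<in> {0..1}"
      show "(\<sigma> has_vector_derivative \<sigma>' x) (at x within {0..1})"
        "(P has_vector_derivative \<sigma> x) (at x within {0..1})"
        "norm (lam\<^sup>2 + 2 * lam * complex_of_real (a x) - complex_of_real (b x) - \<sigma>' x - (\<sigma> x)\<^sup>2)
          \<le> D / norm lam" "\<bar>Re (P x)\<bar> \<le> R + D"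
        using \<sigma> x bounds unfolding wkb_exponent_def by (blast intro: order_trans)+
      show "(\<tau> has_vector_derivative \<tau>' x) (at x within {0..1})"
        "(Q has_vector_derivative \<tau> x) (at x within {0..1})"
        "\<bar>Re (Q x)\<bar> \<le> R + D"
        using \<tau> x bounds by (auto simp: wkb_exponent_def intro: order_trans)
      have "norm (lam\<^sup>2 + 2 * lam * complex_of_real (a x) - complex_of_real (b x) - \<tau>' x - (\<tau> x)\<^sup>2)
          \<le> C2 / norm lam"
        using \<tau> x by (simp add: wkb_exponent_def)
      then show "norm (lam\<^sup>2 + 2 * lam * complex_of_real (a x) - complex_of_real (b x) - \<tau>' x - (\<tau> x)\<^sup>2)
          \<le> D / norm lam"
        using bounds(2) by (rule order_trans)
    qed (use P Q lam0 in simp_all)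
    also have "\<dots> = 16 * D * K\<^sup>2 / (norm lam)\<^sup>2"
      by (simp add: K_def power2_eq_square)
    also have "\<dots> \<le> C / (norm lam)\<^sup>2"
      using D by (intro divide_right_mono) (auto simp: C_def)
    \<comment> \<open>The boundary terms \<open>a 1 - a 0\<close> enter \<open>P 1\<close> and
      \<open>Q 1\<close> with the same sign and cancel.\<close>
    also have "P 1 - Q 1 = 2 * lam + 2 * complex_of_real (mean a)
        - complex_of_real (mean (\<lambda>x. (a x)\<^sup>2 + b x)) / lam"
      using lam0 by (simp add: P Q field_simps)
    finally show "norm (exp (2 * lam + 2 * complex_of_real (mean a)
        - complex_of_real (mean (\<lambda>x. (a x)\<^sup>2 + b x)) / lam) - 1) \<le> C / (norm lam)\<^sup>2" .
  qed
qed

section \<open>Reading off the coefficients\<close>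

lemma tendsto_0_if_of_nat_mult_tendsto:
  fixes f :: "nat \<Rightarrow> complex"
  assumes "(\<lambda>n. of_nat n * f n) \<longlonglongrightarrow> c"
  shows "f \<longlonglongrightarrow> 0"
proof -
  have "(\<lambda>n. of_nat n * f n * (1 / of_nat n)) \<longlonglongrightarrow> c * 0"
    by (intro tendsto_mult assms lim_1_over_n)
  moreover have "\<forall>\<^sub>F n in sequentially. of_nat n * f n * (1 / of_nat n) = f n"
    by (intro eventually_mono[OF eventually_gt_at_top[of 0]]) simp
  ultimately show ?thesis by (simp add: Lim_transform_eventually)
qed

text \<open>Orders 0 and 1 in \<open>1 / n\<close> are compared. The limit of the condition fixes
  \<open>c0 + m\<close> modulo \<pi>i, and realness makes it 0. The exponent then tends to 0, and so
  must its product with \<open>n\<close>, which determines \<open>c1\<close>.\<close>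

lemma asymptotics_of_quantization:
  fixes L e :: "nat \<Rightarrow> complex" and c0 c1 m g :: complex
  assumes L: "\<And>n. L n = complex_of_real pi * of_nat n * \<i> + c0 + c1 / of_nat n + e n"
    and e: "(\<lambda>n. of_nat n * e n) \<longlonglongrightarrow> 0"
    and quant: "\<forall>\<^sub>F n in sequentially. norm (exp (2 * L n + 2 * m - g / L n) - 1) \<le> C / (norm (L n))\<^sup>2"
    and real: "Im c0 = 0" "Im m = 0"
  shows "c0 = - m" "2 * complex_of_real pi * \<i> * c1 = g"
proof -
  have inv: "(\<lambda>n. 1 / of_nat n :: complex) \<longlonglongrightarrow> 0" by (rule lim_1_over_n)
  have e0: "e \<longlonglongrightarrow> 0" by (rule tendsto_0_if_of_nat_mult_tendsto[OF e])
  have "(\<lambda>n. complex_of_real pi * \<i> + c0 * (1 / of_nat n) + c1 * (1 / of_nat n) * (1 / of_nat n)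
      + e n * (1 / of_nat n)) \<longlonglongrightarrow> complex_of_real pi * \<i> + c0 * 0 + c1 * 0 * 0 + 0 * 0"
    by (intro tendsto_intros e0 inv)
  moreover have "\<forall>\<^sub>F n in sequentially. complex_of_real pi * \<i> + c0 * (1 / of_nat n)
      + c1 * (1 / of_nat n) * (1 / of_nat n) + e n * (1 / of_nat n) = L n / of_nat n"
    by (intro eventually_mono[OF eventually_gt_at_top[of 0]]) (simp add: L field_simps)
  ultimately have "(\<lambda>n. L n / of_nat n) \<longlonglongrightarrow> complex_of_real pi * \<i>"
    by (simp add: Lim_transform_eventually)
  from tendsto_inverse[OF this] have q: "(\<lambda>n. of_nat n / L n) \<longlonglongrightarrow> 1 / (complex_of_real pi * \<i>)"
    by (simp add: inverse_eq_divide)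
  have Linv: "(\<lambda>n. 1 / L n) \<longlonglongrightarrow> 0"
    by (rule tendsto_0_if_of_nat_mult_tendsto) (use q in simp)
  \<comment> \<open>The exponent of the quantization condition with the multiple of 2\<pi>i removed,
    so that it converges.\<close>
  define w where "w n = 2 * (c0 + m) + 2 * c1 * (1 / of_nat n) + 2 * e n - g * (1 / L n)" for n
  have "w \<longlonglongrightarrow> 2 * (c0 + m) + 2 * c1 * 0 + 2 * 0 - g * 0"
    unfolding w_def by (intro tendsto_intros e0 inv Linv)
  then have w: "w \<longlonglongrightarrow> 2 * (c0 + m)" by simp
  have expw: "exp (2 * L n + 2 * m - g / L n) = exp (w n)" for n
  proof -
    have "2 * L n + 2 * m - g / L n = w n + 2 * of_nat n * complex_of_real pi * \<i>"
      by (simp add: w_def L algebra_simps)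
    then show ?thesis unfolding exp_eq by (intro exI[of _ "int n"]) simp
  qed
  \<comment> \<open>This is \<open>n\<close> times the error bound, split into a null sequence and a
    convergent one.\<close>
  have "(\<lambda>n. C * norm (1 / L n) * norm (of_nat n / L n)) \<longlonglongrightarrow>
      C * norm (0 :: complex) * norm (1 / (complex_of_real pi * \<i>))"
    by (intro tendsto_mult tendsto_norm tendsto_const Linv q)
  then have lim: "(\<lambda>n. C * norm (1 / L n) * norm (of_nat n / L n)) \<longlonglongrightarrow> 0" by simp
  have n0: "(\<lambda>n. of_nat n * (exp (w n) - 1)) \<longlonglongrightarrow> 0"
  proof (rule Lim_null_comparison[OF _ lim], use quant in eventually_elim)
    case (elim n)
    from mult_left_mono[OF this[unfolded expw], of "real n"] show ?case
      by (simp add: norm_mult norm_divide power2_eq_square mult_ac)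
  qed
  have "(\<lambda>n. exp (w n) - 1) \<longlonglongrightarrow> 0" by (rule tendsto_0_if_of_nat_mult_tendsto[OF n0])
  moreover have "(\<lambda>n. exp (w n) - 1) \<longlonglongrightarrow> exp (2 * (c0 + m)) - 1"
    by (intro tendsto_intros w)
  ultimately have "exp (2 * (c0 + m)) = 1" using LIMSEQ_unique by fastforce
  then have "Re (c0 + m) = 0" by (simp add: exp_eq_1)
  with real show c0: "c0 = - m" by (simp add: complex_eq_iff)
  \<comment> \<open>The Caratheodory form of the derivative of \<open>exp\<close> at 0 transfers the
    limit of \<open>n * w n\<close> to \<open>n * (exp (w n) - 1)\<close> without a
    logarithm.\<close>
  obtain h :: "complex \<Rightarrow> complex" where h: "\<And>z. exp z - 1 = h z * z" "isCont h 0" "h 0 = 1"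
    using DERIV_exp[of "0 :: complex"] unfolding CARAT_DERIV by auto
  have "w \<longlonglongrightarrow> 0" using w c0 by simp
  then have hw: "(\<lambda>n. h (w n)) \<longlonglongrightarrow> 1" using isCont_tendsto_compose[OF h(2)] h(3) by simp
  have "(\<lambda>n. 2 * c1 + 2 * (of_nat n * e n) - g * (of_nat n / L n)) \<longlonglongrightarrow>
      2 * c1 + 2 * 0 - g * (1 / (complex_of_real pi * \<i>))"
    by (intro tendsto_intros e q)
  moreover have "\<forall>\<^sub>F n in sequentially.
      2 * c1 + 2 * (of_nat n * e n) - g * (of_nat n / L n) = of_nat n * w n"
    by (intro eventually_mono[OF eventually_gt_at_top[of 0]]) (simp add: w_def c0 algebra_simps)
  ultimately have "(\<lambda>n. of_nat n * w n) \<longlonglongrightarrow> 2 * c1 + 2 * 0 - g * (1 / (complex_of_real pi * \<i>))"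
    by (rule Lim_transform_eventually)
  from tendsto_mult[OF hw this] have "(\<lambda>n. of_nat n * (exp (w n) - 1)) \<longlonglongrightarrow>
      2 * c1 - g * (1 / (complex_of_real pi * \<i>))"
    by (simp add: h(1) mult_ac)
  from LIMSEQ_unique[OF this n0] show "2 * complex_of_real pi * \<i> * c1 = g"
    by (simp add: field_simps)
qed

section \<open>Constancy as vanishing variance\<close>

text \<open>The difference of the two sides is the integral of
  \<open>(a x - mean a)\<^sup>2\<close>, and a continuous nonnegative function with integral 0
  vanishes.\<close>

lemma mean_square_eq_iff:
  assumes "continuous_on {0..1} a"
  shows "mean (\<lambda>x. (a x)\<^sup>2) = (mean a)\<^sup>2 \<longleftrightarrow> (\<forall>x\<in>{0..1}. a x = mean a)"
proof -
  have int: "a integrable_on {0..1}" "(\<lambda>x. (a x)\<^sup>2) integrable_on {0..1}"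
    by (intro integrable_continuous_real continuous_intros assms)+
  have "((\<lambda>x. (a x)\<^sup>2 - 2 * mean a * a x + (mean a)\<^sup>2) has_integral
      mean (\<lambda>x. (a x)\<^sup>2) - 2 * mean a * mean a + (mean a)\<^sup>2) {0..1}"
    using int has_integral_const_real[of "(mean a)\<^sup>2" 0 1]
    by (intro has_integral_add has_integral_diff has_integral_mult_right)
      (auto simp: mean_def integrable_integral)
  moreover have "(\<lambda>x. (a x)\<^sup>2 - 2 * mean a * a x + (mean a)\<^sup>2) = (\<lambda>x. (a x - mean a)\<^sup>2)"
    by (simp add: power2_diff algebra_simps)
  ultimately have "integral {0..1} (\<lambda>x. (a x - mean a)\<^sup>2) = mean (\<lambda>x. (a x)\<^sup>2) - (mean a)\<^sup>2"
    by (simp add: integral_unique power2_eq_square)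
  then have "mean (\<lambda>x. (a x)\<^sup>2) = (mean a)\<^sup>2 \<longleftrightarrow> integral {0..1} (\<lambda>x. (a x - mean a)\<^sup>2) = 0"
    by simp
  also have "\<dots> \<longleftrightarrow> (\<forall>x\<in>{0..1}. (a x - mean a)\<^sup>2 = 0)"
    by (rule integral_eq_0_iff) (auto intro!: continuous_intros assms)
  finally show ?thesis by simp
qed

lemma constant_on_iff_eq_mean: "a constant_on {0..1} \<longleftrightarrow> (\<forall>x\<in>{0..1}. a x = mean a)"
proof
  assume "a constant_on {0..1}"
  then obtain c where c: "\<And>x. x \<in> {0..1} \<Longrightarrow> a x = c" by (auto simp: constant_on_def)
  then have "mean a = integral {0..1} (\<lambda>x::real. c)"
    unfolding mean_def by (intro integral_cong) auto
  with c show "\<forall>x\<in>{0..1}. a x = mean a" by simp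
qed (auto simp: constant_on_def)

section \<open>The eigenvalue sequence at both ends\<close>

text \<open>Meant for \<open>k n = n\<close> and \<open>k n = - n\<close>, so that the error terms
  at both ends become ordinary sequences.\<close>

lemma of_nat_mult_inverse_square_bigo_tendsto_0:
  fixes f :: "int \<Rightarrow> complex" and k :: "nat \<Rightarrow> int"
  assumes f: "f \<in> O[F](\<lambda>n. 1 / (of_int n)\<^sup>2)"
    and k: "filterlim k F sequentially" "\<And>n. \<bar>k n\<bar> = int n"
  shows "(\<lambda>n. of_nat n * f (k n)) \<longlonglongrightarrow> 0"
proof -
  obtain c where "\<forall>\<^sub>F n in F. norm (f n) \<le> c * norm (1 / (of_int n :: complex)\<^sup>2)"
    using f by (rule landau_o.bigE)
  then have "\<forall>\<^sub>F n in sequentially. norm (f (k n)) \<le> c * norm (1 / (of_int (k n) :: complex)\<^sup>2)"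
    by (rule eventually_compose_filterlim[OF _ k(1)])
  then have "\<forall>\<^sub>F n in sequentially. norm (of_nat n * f (k n)) \<le> c * (1 / real n)"
    using eventually_gt_at_top[of 0]
  proof eventually_elim
    case (elim n)
    have "norm (of_int (k n) :: complex) = real n"
      using k(2)[of n] by (metis norm_of_int of_int_abs of_int_of_nat_eq)
    then have "norm (f (k n)) \<le> c * (1 / (real n)\<^sup>2)"
      using elim by (simp only: norm_divide norm_power norm_one)
    from mult_left_mono[OF this, of "real n"] elim show ?case
      by (simp add: norm_mult power2_eq_square)
  qed
  moreover have "(\<lambda>n. c * (1 / real n)) \<longlonglongrightarrow> 0"
    using tendsto_mult[OF tendsto_const lim_1_over_n, of c] by simp
  ultimately show ?thesis by (rule Lim_null_comparison)
qed

theorem corollary2: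
  fixes a b :: "real \<Rightarrow> real" and lam :: "int \<Rightarrow> complex" and c0 c1 :: complex
  assumes "Ck_on 3 a {0..1}"
    and "Ck_on 2 b {0..1}"
    and "eigenvalue_enumeration a b lam"
    and "eigenvalue_asymptotics lam c0 c1"
  shows "(a constant_on {0..1} \<longleftrightarrow>
            c0\<^sup>2 = 2 * complex_of_real pi * \<i> * c1 - complex_of_real (mean b)) \<and>
         (a constant_on {0..1} \<longrightarrow> (\<forall>x\<in>{0..1}. complex_of_real (a x) = - c0))"
proof -
  obtain a' a'' a''' where a: "\<And>x. x \<in> {0..1} \<Longrightarrow> (a has_real_derivative a' x) (at x within {0..1})"
    and a': "\<And>x. x \<in> {0..1} \<Longrightarrow> (a' has_real_derivative a'' x) (at x within {0..1})"
    and a'': "\<And>x. x \<in> {0..1} \<Longrightarrow> (a'' has_real_derivative a''' x) (at x within {0..1})"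
    using assms(1) unfolding numeral_3_eq_3 Ck_on.simps by metis
  obtain b' b'' where b: "\<And>x. x \<in> {0..1} \<Longrightarrow> (b has_real_derivative b' x) (at x within {0..1})"
    and b': "\<And>x. x \<in> {0..1} \<Longrightarrow> (b' has_real_derivative b'' x) (at x within {0..1})"
    using assms(2) unfolding numeral_2_eq_2 Ck_on.simps by metis
  have cont: "continuous_on {0..1} a" "continuous_on {0..1} a''"
      "continuous_on {0..1} b" "continuous_on {0..1} b'"
    using a a'' b b' unfolding continuous_on_eq_continuous_within
    by (blast intro: DERIV_continuous)+
  define g where "g = mean (\<lambda>x. (a x)\<^sup>2 + b x)"
  \<comment> \<open>The strip is wide enough for all eigenvalues of large positive index, since
    their real parts tend to \<open>Re c0\<close>.\<close>
  obtain C where C: "\<And>lam. \<lbrakk>is_eigenvalue a b lam; \<bar>Re lam\<bar> \<le> \<bar>Re c0\<bar> + 1; C \<le> norm lam\<rbrakk> \<Longrightarrow>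
      norm (exp (2 * lam + 2 * complex_of_real (mean a) - complex_of_real g / lam) - 1)
        \<le> C / (norm lam)\<^sup>2"
    unfolding g_def by (rule eigenvalue_quantization[OF a a' cont(2) b cont(4)]) auto
  define E where "E n = lam n - (complex_of_real pi * of_int n * \<i> + c0 + c1 / of_int n)" for n
  have E: "E \<in> O[at_top](\<lambda>n. 1 / (of_int n)\<^sup>2)" "E \<in> O[at_bot](\<lambda>n. 1 / (of_int n)\<^sup>2)"
    using assms(4) unfolding eigenvalue_asymptotics_def E_def[abs_def] by auto
  have "filterlim (\<lambda>n. - int n) at_bot sequentially"
    unfolding filterlim_at_bot
  proof
    show "\<forall>\<^sub>F n in sequentially. - int n \<le> Z" for Z
      using eventually_ge_at_top[of "nat (- Z)"] by eventually_elim linarith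
  qed
  from of_nat_mult_inverse_square_bigo_tendsto_0[OF E(2) this]
  have E_neg: "(\<lambda>n. of_nat n * E (- int n)) \<longlonglongrightarrow> 0" by simp
  have E_pos: "(\<lambda>n. of_nat n * E (int n)) \<longlonglongrightarrow> 0"
    by (rule of_nat_mult_inverse_square_bigo_tendsto_0[OF E(1) filterlim_int_sequentially]) simp
  define L where "L n = lam (int n)" for n
  have L: "L n = complex_of_real pi * of_nat n * \<i> + c0 + c1 / of_nat n + E (int n)" for n
    by (simp add: L_def E_def)
  define r where "r n = c0 + c1 * (1 / of_nat n) + E (int n)" for n
  have "r \<longlonglongrightarrow> c0 + c1 * 0 + 0"
    unfolding r_def
    by (intro tendsto_intros lim_1_over_n tendsto_0_if_of_nat_mult_tendsto[OF E_pos])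
  then have r: "r \<longlonglongrightarrow> c0" by simp
  have near: "\<forall>\<^sub>F n in sequentially. norm (r n - c0) < 1"
    using tendstoD[OF r, of 1] by (simp add: dist_norm)
  have Re_L: "\<forall>\<^sub>F n in sequentially. \<bar>Re (L n)\<bar> \<le> \<bar>Re c0\<bar> + 1"
    using near
  proof eventually_elim
    case (elim n)
    have "Re (L n) = Re c0 + Re (r n - c0)" by (simp add: L r_def)
    then show ?case using abs_Re_le_cmod[of "r n - c0"] elim by linarith
  qed
  have Im_L: "\<forall>\<^sub>F n in sequentially. B \<le> Im (L n)" for B
    using near eventually_ge_at_top[of "nat \<lceil>B + \<bar>Im c0\<bar> + 1\<rceil>"]
  proof eventually_elim
    case (elim n)
    have "Im (L n) = pi * real n + Im c0 + Im (r n - c0)" by (simp add: L r_def)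
    moreover have "1 * real n \<le> pi * real n" using pi_gt3 by (intro mult_right_mono) auto
    moreover have "B + \<bar>Im c0\<bar> + 1 \<le> real n" using elim(2) by linarith
    ultimately show ?case using abs_Im_le_cmod[of "r n - c0"] elim(1) by linarith
  qed
  \<comment> \<open>The sequence \<open>lam (- n)\<close> plus \<pi>in tends to \<open>c0\<close> by
    the expansion at minus infinity and to \<open>cnj c0\<close> by conjugation symmetry, so
    \<open>c0\<close> is real.\<close>
  have "(\<lambda>n. c0 - c1 * (1 / of_nat n) + E (- int n)) \<longlonglongrightarrow> c0 - c1 * 0 + 0"
    by (intro tendsto_intros lim_1_over_n tendsto_0_if_of_nat_mult_tendsto[OF E_neg])
  \<comment> \<open>The symmetry is available only for non-real eigenvalues; an imaginary part of at
    least 1 ensures this.\<close>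
  moreover have "\<forall>\<^sub>F n in sequentially. c0 - c1 * (1 / of_nat n) + E (- int n) = cnj (r n)"
    using Im_L[of 1] eventually_gt_at_top[of 0]
  proof eventually_elim
    case (elim n)
    have "lam (int n) \<notin> \<real>" using elim by (auto simp: L_def complex_is_Real_iff)
    then have "lam (- int n) = cnj (L n)"
      using assms(3) elim unfolding eigenvalue_enumeration_def L_def by auto
    then show ?case by (simp add: E_def L r_def)
  qed
  ultimately have "(\<lambda>n. cnj (r n)) \<longlonglongrightarrow> c0" by (simp add: Lim_transform_eventually)
  from LIMSEQ_unique[OF this tendsto_cnj[OF r]] have real: "Im c0 = 0"
    by (metis complex_cnj_cancel_iff complex_is_Real_iff Reals_cnj_iff)
  have "\<forall>\<^sub>F n in sequentially.
      norm (exp (2 * L n + 2 * complex_of_real (mean a) - complex_of_real g / L n) - 1)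
        \<le> C / (norm (L n))\<^sup>2"
    using Re_L Im_L[of C] eventually_gt_at_top[of 0]
  proof eventually_elim
    case (elim n)
    have "is_eigenvalue a b (L n)"
      using assms(3) elim(3) unfolding eigenvalue_enumeration_def L_def by auto
    moreover have "C \<le> norm (L n)" using elim(2) abs_Im_le_cmod[of "L n"] by linarith
    ultimately show ?case using elim(1) by (intro C)
  qed
  from asymptotics_of_quantization[OF L E_pos this real]
  have c0: "c0 = - complex_of_real (mean a)" and c1: "2 * complex_of_real pi * \<i> * c1 = complex_of_real g"
    by simp_all
  have "g = mean (\<lambda>x. (a x)\<^sup>2) + mean b"
    unfolding g_def mean_def
    by (intro integral_add integrable_continuous_real continuous_intros cont)
  then have "c0\<^sup>2 = 2 * complex_of_real pi * \<i> * c1 - complex_of_real (mean b) \<longleftrightarrow>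
      complex_of_real ((mean a)\<^sup>2) = complex_of_real (mean (\<lambda>x. (a x)\<^sup>2))"
    by (simp add: c0 c1)
  also have "\<dots> \<longleftrightarrow> a constant_on {0..1}"
    unfolding of_real_eq_iff constant_on_iff_eq_mean
    using mean_square_eq_iff[OF cont(1)] by auto
  finally show ?thesis
    unfolding constant_on_iff_eq_mean by (simp add: c0)
qed

end
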